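(* If a non-principal ultrafilter $\alpha$ on $\mathbb{N}$ is flat, then $\alpha$ does not have the $3$f-property.
   Context: $\mathbb{N}=\{1,2,3,\dots\}$. Flat ultrafilters: let $\mathbb{N}^{\mathbb{N}\uparrow}$ denote the set of strictly increasing functions $f:\mathbb{N}\to\mathbb{N}$. Put $f^0(1)=1$ and $f^{k+1}(1)=f(f^k(1))$. For $x=(\eta_i)\in\ell^\infty$, $f\in\mathbb{N}^{\mathbb{N}\uparrow}$ and $k\in\mathbb{N}$ let $\omega_f^k(x)=\max\{|\eta_i-\eta_j|: f^{k-1}(1)\le i\le j<f^k(1)\}$ (equal to $0$ if there are no such $i,j$), and $\omega_f(x)=\sup_{k\in\mathbb{N}}\omega_f^k(x)$. A flatness scale for $\alpha$ is a sequence $(s_n)_{n\in\mathbb{N}}$ in $[0,1]^{\mathbb{N}}$ such that (i) there exists $r>0$ with $\sup_i s_n(i)\ge r$ and $\lim_{i\to\infty}s_n(i)=0$ for every $n\in\mathbb{N}$, and (ii) $\lim_{n\to\alpha}\omega_f(s_n)=0$ for every $f\in\mathbb{N}^{\mathbb{N}\uparrow}$. The non-principal ultrafilter $\alpha$ is flat if it admits a flatness scale. $3$f-property: the non-principal ultrafilter $\alpha$ on $\mathbb{N}$ has the three functions property ($3$f-property) if there exists a bijection $\phi:\mathbb{N}\to\mathbb{N}^2$ such that for every $f:\mathbb{N}\to\mathbb{N}$ there exists $A\in\alpha$ satisfying one of: (i) $f|_A$ is constant; (ii) $f|_A$ is finite-to-one; (iii) there is a one-to-one function $\bar f:\mathbb{N}\to\mathbb{N}$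 such that $f|_A=\bar f\circ\pi\circ\phi|_A$, where $\pi:\mathbb{N}^2\to\mathbb{N}$ is the projection onto the first coordinate. *)

theory Defs
  imports Complex_Main "HOL-Library.FuncSet"
begin

text \<open>
  The natural numbers here start at 1. They are represented as the subset \<open>{1..}\<close> of type
  \<^typ>\<open>nat\<close>; functions and sequences are only constrained on that subset.
\<close>

abbreviation Npos :: "nat set" where
  "Npos \<equiv> {1..}"

text \<open>
  A family of subsets of \<open>X\<close> is represented by a filter \<open>\<alpha>\<close> concentrated on \<open>X\<close>, with
  membership of \<open>A\<close> in the family rendered as \<open>\<forall>\<^sub>F x in \<alpha>. x \<in> A\<close>. The library's convergence
  \<open>(g \<longlongrightarrow> l) \<alpha>\<close> is then the limit along \<open>\<alpha>\<close>.
\<close>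

definition ultrafilter_on :: "'a set \<Rightarrow> 'a filter \<Rightarrow> bool" where
  "ultrafilter_on X \<alpha> \<longleftrightarrow>
     \<alpha> \<noteq> bot \<and> (\<forall>\<^sub>F x in \<alpha>. x \<in> X) \<and>
     (\<forall>A\<subseteq>X. (\<forall>\<^sub>F x in \<alpha>. x \<in> A) \<or> (\<forall>\<^sub>F x in \<alpha>. x \<in> X - A))"

definition nonprincipal_ultrafilter_on :: "'a set \<Rightarrow> 'a filter \<Rightarrow> bool" where
  "nonprincipal_ultrafilter_on X \<alpha> \<longleftrightarrow>
     ultrafilter_on X \<alpha> \<and> (\<forall>a\<in>X. \<alpha> \<noteq> principal {a})"

definition increasing_funs :: "(nat \<Rightarrow> nat) set" where
  "increasing_funs = {f. f \<in> Npos \<rightarrow> Npos \<and> strict_mono_on Npos f}"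

text \<open>Meaningful for block numbers \<open>k \<ge> 1\<close>.\<close>

definition block_osc :: "(nat \<Rightarrow> nat) \<Rightarrow> nat \<Rightarrow> (nat \<Rightarrow> real) \<Rightarrow> real" where
  "block_osc f k x =
     (let D = {\<bar>x i - x j\<bar> | i j. (f ^^ (k - 1)) 1 \<le> i \<and> i \<le> j \<and> j < (f ^^ k) 1}
      in if D = {} then 0 else Max D)"

text \<open>
  The supremum is taken in \<^typ>\<open>real\<close>, so it is the intended one for bounded sequences \<open>x\<close>.
\<close>

definition osc :: "(nat \<Rightarrow> nat) \<Rightarrow> (nat \<Rightarrow> real) \<Rightarrow> real" where
  "osc f x = (SUP k\<in>Npos. block_osc f k x)"

definition flatness_scale :: "nat filter \<Rightarrow> (nat \<Rightarrow> nat \<Rightarrow> real) \<Rightarrow> bool" where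
  "flatness_scale \<alpha> s \<longleftrightarrow>
     (\<forall>n\<in>Npos. \<forall>i\<in>Npos. s n i \<in> {0..1}) \<and>
     (\<exists>r>0. \<forall>n\<in>Npos. (SUP i\<in>Npos. s n i) \<ge> r \<and> s n \<longlonglongrightarrow> 0) \<and>
     (\<forall>f\<in>increasing_funs. ((\<lambda>n. osc f (s n)) \<longlongrightarrow> 0) \<alpha>)"

definition flat :: "nat filter \<Rightarrow> bool" where
  "flat \<alpha> \<longleftrightarrow> (\<exists>s. flatness_scale \<alpha> s)"

definition finite_to_one_on :: "('a \<Rightarrow> 'b) \<Rightarrow> 'a set \<Rightarrow> bool" where
  "finite_to_one_on f A \<longleftrightarrow> (\<forall>m. finite {n \<in> A. f n = m})"

definition three_functions_property :: "nat filter \<Rightarrow> bool" where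
  "three_functions_property \<alpha> \<longleftrightarrow>
     (\<exists>\<phi>. bij_betw \<phi> Npos (Npos \<times> Npos) \<and>
       (\<forall>f \<in> Npos \<rightarrow> Npos. \<exists>A\<subseteq>Npos. (\<forall>\<^sub>F n in \<alpha>. n \<in> A) \<and>
         ((\<exists>c. \<forall>n\<in>A. f n = c) \<or>
          finite_to_one_on f A \<or>
          (\<exists>g \<in> Npos \<rightarrow> Npos. inj_on g Npos \<and> (\<forall>n\<in>A. f n = g (fst (\<phi> n)))))))"

end

(*
  For a flatness scale s and 0 < c < r let h c n be the last index at which s n is at least c.
  Along the ultrafilter, s n varies so slowly that, for d < c, no function of h c n bounds h d n.
  If h c and h d fall under the same alternative of the three functions property, then such a
  bound does exist. Among four thresholds, two fall under the same alternative.
*)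

theory Submission imports Defs begin

section \<open>Oscillation over blocks of iterates\<close>

lemma increasing_funs_funpow_ge_1:
  assumes "f \<in> increasing_funs"
  shows "(f ^^ k) 1 \<ge> 1"
  using assms by (induction k) (auto simp: increasing_funs_def)

lemma block_elements_finite:
  fixes x :: "nat \<Rightarrow> real"
  shows "finite {\<bar>x i - x j\<bar> | i j. a \<le> i \<and> i \<le> j \<and> j < b}"
proof (rule finite_subset)
  show "{\<bar>x i - x j\<bar> | i j. a \<le> i \<and> i \<le> j \<and> j < b} \<subseteq> (\<lambda>(i, j). \<bar>x i - x j\<bar>) ` ({..<b} \<times> {..<b})"
    by force
qed auto

text \<open>This makes the block oscillations bounded above, so that the real supremum in
  \<open>osc\<close> dominates each of them.\<close>

lemma block_osc_le_1:
  assumes f: "f \<in> increasing_funs" and x: "\<And>i. i \<ge> 1 \<Longrightarrow> x i \<in> {0..1}"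
  shows "block_osc f k x \<le> 1"
proof -
  let ?D = "{\<bar>x i - x j\<bar> | i j. (f ^^ (k - 1)) 1 \<le> i \<and> i \<le> j \<and> j < (f ^^ k) 1}"
  have "d \<le> 1" if "d \<in> ?D" for d
  proof -
    from that obtain i j where ij: "d = \<bar>x i - x j\<bar>" "(f ^^ (k - 1)) 1 \<le> i" "i \<le> j" by blast
    with increasing_funs_funpow_ge_1[OF f, of "k - 1"] have "i \<ge> 1" "j \<ge> 1" by linarith+
    then show ?thesis using x[of i] x[of j] ij by auto
  qed
  then show ?thesis
    using Max_in[OF block_elements_finite] by (simp only: block_osc_def Let_def) force
qed

lemma abs_diff_le_osc:
  assumes f: "f \<in> increasing_funs" and x: "\<And>i. i \<ge> 1 \<Longrightarrow> x i \<in> {0..1}"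
    and ij: "(f ^^ k) 1 \<le> i" "i \<le> j" "j < (f ^^ Suc k) 1"
  shows "\<bar>x i - x j\<bar> \<le> osc f x"
proof -
  let ?D = "{\<bar>x i - x j\<bar> | i j. (f ^^ (Suc k - 1)) 1 \<le> i \<and> i \<le> j \<and> j < (f ^^ Suc k) 1}"
  have mem: "\<bar>x i - x j\<bar> \<in> ?D" using ij by (auto simp del: funpow.simps)
  then have "\<bar>x i - x j\<bar> \<le> Max ?D" by (intro Max_ge block_elements_finite)
  also have "Max ?D = block_osc f (Suc k) x"
    using mem unfolding block_osc_def Let_def by (metis (lifting) empty_iff)
  also have "\<dots> \<le> osc f x"
    unfolding osc_def by (intro cSUP_upper) (auto intro!: bdd_aboveI2 block_osc_le_1[OF f x])
  finally show ?thesis .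
qed

section \<open>Pairing consecutive blocks\<close>

lemma increasing_funs_comp_self:
  assumes "F \<in> increasing_funs"
  shows "F \<circ> F \<in> increasing_funs"
  using assms by (auto simp: increasing_funs_def strict_mono_on_def Pi_def)

text \<open>The blocks of \<open>F \<circ> F\<close> end at the even iterates of \<open>F\<close> at
  1. Here the exceptional value at 1 makes the first step single and all later ones double, so the
  ends are the odd iterates.\<close>

lemma increasing_funs_staggered:
  assumes F: "F \<in> increasing_funs" and gt: "\<And>m. F m > m"
  shows "(\<lambda>m. if m = 1 then F 1 else F (F m)) \<in> increasing_funs"
proof -
  have "F 1 < F (F m)" if "m > 1" for m
  proof -
    have "F 1 < F m" using F that by (auto simp: increasing_funs_def strict_mono_on_def)
    then show ?thesis using gt[of "F m"] by (rule less_trans)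
  qed
  then show ?thesis
    using increasing_funs_comp_self[OF F] F
    by (auto simp: increasing_funs_def strict_mono_on_def Pi_def)
qed

lemma funpow_comp_self: "((F \<circ> F) ^^ l) (a::'a) = (F ^^ (2 * l)) a"
  by (induction l) auto

lemma funpow_staggered:
  fixes F :: "nat \<Rightarrow> nat"
  assumes gt: "\<And>m. F m > m"
  shows "((\<lambda>m. if m = 1 then F 1 else F (F m)) ^^ Suc l) 1 = (F ^^ Suc (2 * l)) 1"
proof (induction l)
  case (Suc l)
  \<comment> \<open>From the first step on, the iterates exceed 1, so the exceptional branch never
    recurs.\<close>
  have "(F ^^ k) 1 \<ge> 1" for k by (induction k) (use gt less_imp_le order_trans in auto, fastforce)
  then have "(F ^^ Suc (2 * l)) 1 \<noteq> 1" using gt[of "(F ^^ (2 * l)) 1"]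
    by (metis funpow.simps(2) comp_apply leD)
  then show ?case using Suc by simp
qed simp

text \<open>The iterates are unbounded because \<open>F m > m\<close>; the least iterate beyond
  \<open>i\<close> ends the block that contains \<open>i\<close>.\<close>

lemma funpow_block_exists:
  fixes F :: "nat \<Rightarrow> nat"
  assumes gt: "\<And>m. F m > m" and "i \<ge> 1"
  obtains k where "(F ^^ k) 1 \<le> i" "i < (F ^^ Suc k) 1"
proof -
  have "(F ^^ k) 1 \<ge> k" for k
    by (induction k) (use gt in \<open>auto simp: Suc_le_eq intro: le_less_trans\<close>)
  then have ex: "\<exists>k. i < (F ^^ k) 1" using Suc_le_lessD by blast
  define k where "k = (LEAST k. i < (F ^^ k) 1)"
  have k: "i < (F ^^ k) 1" unfolding k_def using ex by (rule LeastI_ex)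
  with \<open>i \<ge> 1\<close> have "k \<noteq> 0" by (metis funpow_0 leD)
  then obtain k' where k': "k = Suc k'" by (cases k) auto
  have "\<not> i < (F ^^ k') 1" using k' not_less_Least unfolding k_def by (metis lessI)
  with k k' show ?thesis using that[of k'] by auto
qed

text \<open>
  The oscillation does not see the jump between two consecutive blocks of \<open>F\<close>. Two consecutive
  blocks lie in one block of \<open>F \<circ> F\<close> or in one block of a staggered variant of it.
\<close>

lemma abs_diff_le_max_osc:
  assumes F: "F \<in> increasing_funs" and gt: "\<And>m. F m > m" and x: "\<And>i. i \<ge> 1 \<Longrightarrow> x i \<in> {0..1}"
    and ij: "1 \<le> i" "i \<le> j" "j \<le> F i"
  shows "\<bar>x i - x j\<bar> \<le> max (osc (F \<circ> F) x) (osc (\<lambda>m. if m = 1 then F 1 else F (F m)) x)"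
proof -
  obtain k where k: "(F ^^ k) 1 \<le> i" "i < (F ^^ Suc k) 1"
    using funpow_block_exists[OF gt \<open>1 \<le> i\<close>] by blast
  \<comment> \<open>Hence \<open>j\<close> lies in the same block as \<open>i\<close> or in the next
    one.\<close>
  have "F i < F ((F ^^ Suc k) 1)"
    using F k(2) ij increasing_funs_funpow_ge_1[OF F, of "Suc k"]
    unfolding increasing_funs_def strict_mono_on_def by (auto simp del: funpow.simps)
  with ij have j: "j < (F ^^ Suc (Suc k)) 1" by simp
  show ?thesis
  proof (cases "even k")
    case True
    then obtain l where l: "k = 2 * l" by blast
    have "\<bar>x i - x j\<bar> \<le> osc (F \<circ> F) x"
    proof (rule abs_diff_le_osc[where k = l, OF increasing_funs_comp_self[OF F] x])
      show "((F \<circ> F) ^^ l) 1 \<le> i" unfolding funpow_comp_self using k l by simp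
      show "j < ((F \<circ> F) ^^ Suc l) 1" unfolding funpow_comp_self using j l by simp
    qed (use ij in auto)
    then show ?thesis by simp
  next
    case False
    then obtain l where l: "k = Suc (2 * l)" using oddE by fastforce
    have "\<bar>x i - x j\<bar> \<le> osc (\<lambda>m. if m = 1 then F 1 else F (F m)) x"
    \<comment> \<open>The index is \<open>Suc l\<close> because staggered block 0 is the short one
      from 1 to \<open>F 1\<close>.\<close>
    proof (rule abs_diff_le_osc[where k = "Suc l", OF increasing_funs_staggered[OF F gt] x])
      show "((\<lambda>m. if m = 1 then F 1 else F (F m)) ^^ Suc l) 1 \<le> i"
        unfolding funpow_staggered[OF gt] using k l by simp
      show "j < ((\<lambda>m. if m = 1 then F 1 else F (F m)) ^^ Suc (Suc l)) 1"
        unfolding funpow_staggered[OF gt] using j l by simp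
    qed (use ij in auto)
    then show ?thesis by simp
  qed
qed

section \<open>Last indices above a threshold\<close>

definition last_above :: "(nat \<Rightarrow> real) \<Rightarrow> real \<Rightarrow> nat" where
  "last_above x c = Max {i. i \<ge> 1 \<and> x i \<ge> c}"

text \<open>The set under \<open>Max\<close> is finite because \<open>x\<close> tends to 0 <
  \<open>c\<close>, and nonempty because \<open>c\<close> lies below the supremum.\<close>

lemma
  assumes x: "\<And>i. i \<ge> 1 \<Longrightarrow> x i \<in> {0..1}" and lim: "x \<longlonglongrightarrow> 0"
    and sup: "(SUP i\<in>Npos. x i) \<ge> r" and c: "0 < c" "c < r"
  shows last_above_ge_1: "last_above x c \<ge> 1"
    and le_at_last_above: "x (last_above x c) \<ge> c"
    and le_last_above: "\<And>i. i \<ge> 1 \<Longrightarrow> x i \<ge> c \<Longrightarrow> i \<le> last_above x c"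
proof -
  let ?S = "{i. i \<ge> 1 \<and> x i \<ge> c}"
  obtain N where N: "\<And>n. n \<ge> N \<Longrightarrow> x n < c"
    using order_tendstoD(2)[OF lim c(1)] by (auto simp: eventually_sequentially)
  have fin: "finite ?S"
  proof (rule finite_subset)
    show "?S \<subseteq> {..<N}" using N by (auto simp: not_le[symmetric])
  qed simp
  have "\<exists>i\<in>Npos. c < x i"
  proof (subst less_cSUP_iff[symmetric])
    show "bdd_above (x ` Npos)" using x by (intro bdd_aboveI2[of _ _ 1]) auto
  qed (use sup c in auto)
  then have "?S \<noteq> {}" by (auto intro: less_imp_le)
  then have "last_above x c \<in> ?S" unfolding last_above_def by (intro Max_in fin)
  then show "last_above x c \<ge> 1" "x (last_above x c) \<ge> c" by auto
  show "i \<le> last_above x c" if "i \<ge> 1" "x i \<ge> c" for i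
    unfolding last_above_def using that fin by (intro Max_ge) auto
qed

lemma increasing_majorant_exists:
  fixes b :: "nat \<Rightarrow> nat"
  obtains F where "F \<in> increasing_funs" "\<And>m. F m > m" "\<And>m. F m > b m"
proof -
  \<comment> \<open>Every summand is at least 1, so the sums increase strictly and exceed
    \<open>m\<close>; the last summand alone exceeds \<open>b m\<close>.\<close>
  define F where "F m = (\<Sum>i\<le>m. b i + 1)" for m
  have "strict_mono F" by (simp add: F_def strict_mono_Suc_iff)
  moreover have "F m > b m" "F m > m" for m
    by (induction m) (auto simp: F_def)
  moreover from this have "F m \<ge> 1" for m by (metis One_nat_def Suc_leI less_nat_zero_code neq0_conv)
  ultimately show ?thesis
    using that[of F] by (auto simp: increasing_funs_def strict_mono_on_def strict_mono_def)
qed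

text \<open>Otherwise some increasing \<open>F\<close>, independent of \<open>n\<close>, sends the
  last index at level \<open>c\<close> beyond the one at level \<open>d\<close>. Then
  \<open>s n\<close> drops by more than \<open>c - d\<close> between some \<open>i\<close> and some
  \<open>j \<le> F i\<close>, which flatness forbids for \<open>\<alpha>\<close>-most
  \<open>n\<close>.\<close>

lemma flatness_scale_last_above_unbounded:
  assumes s01: "\<And>n i. n \<ge> 1 \<Longrightarrow> i \<ge> 1 \<Longrightarrow> s n i \<in> {0..1}"
    and sup: "\<And>n. n \<ge> 1 \<Longrightarrow> (SUP i\<in>Npos. s n i) \<ge> r"
    and lim: "\<And>n. n \<ge> 1 \<Longrightarrow> s n \<longlonglongrightarrow> 0"
    and osc: "\<And>f. f \<in> increasing_funs \<Longrightarrow> ((\<lambda>n. osc f (s n)) \<longlongrightarrow> 0) \<alpha>"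
    and "\<alpha> \<noteq> bot" and A: "A \<subseteq> Npos" "\<forall>\<^sub>F n in \<alpha>. n \<in> A"
    and dc: "0 < d" "d < c" "c < r"
  shows "\<exists>m. infinite ((\<lambda>n. last_above (s n) d) ` {n \<in> A. last_above (s n) c = m})"
proof (rule ccontr)
  let ?B = "\<lambda>m. (\<lambda>n. last_above (s n) d) ` {n \<in> A. last_above (s n) c = m}"
  assume "\<not> ?thesis"
  then have fin: "finite (?B m)" for m by blast
  \<comment> \<open>For an empty \<open>?B m\<close> the value of \<open>Max\<close> is unspecified;
    this is harmless, as the bound is applied only at an \<open>m\<close> attained on
    \<open>A\<close>.\<close>
  obtain F where F: "F \<in> increasing_funs" and gt: "\<And>m. F m > m" and B: "\<And>m. F m > Max (?B m)"
    using increasing_majorant_exists[of "\<lambda>m. Max (?B m)"] by blast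
  let ?G = "\<lambda>m. if m = 1 then F 1 else F (F m)"
  have "\<forall>\<^sub>F n in \<alpha>. osc (F \<circ> F) (s n) < c - d"
    using dc by (intro order_tendstoD(2)[OF osc] increasing_funs_comp_self F) auto
  moreover have "\<forall>\<^sub>F n in \<alpha>. osc ?G (s n) < c - d"
    using dc by (intro order_tendstoD(2)[OF osc] increasing_funs_staggered F gt) auto
  ultimately have "\<forall>\<^sub>F n in \<alpha>. n \<in> A \<and> osc (F \<circ> F) (s n) < c - d \<and> osc ?G (s n) < c - d"
    using A(2) by eventually_elim blast
  from eventually_happens'[OF \<open>\<alpha> \<noteq> bot\<close> this]
  obtain n where n: "n \<in> A" "osc (F \<circ> F) (s n) < c - d" "osc ?G (s n) < c - d" by blast
  with A have n1: "n \<ge> 1" by auto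
  note la = last_above_ge_1 le_at_last_above le_last_above
  note la_c = la[OF s01[OF n1] lim[OF n1] sup[OF n1], of c]
  note la_d = la[OF s01[OF n1] lim[OF n1] sup[OF n1], of d]
  \<comment> \<open>At \<open>?j\<close>, one past the last index at level \<open>d\<close>, the
    sequence is already below \<open>d\<close>. The strict bound \<open>B\<close> absorbs this
    successor.\<close>
  let ?i = "last_above (s n) c" and ?j = "Suc (last_above (s n) d)"
  have i: "?i \<ge> 1" "s n ?i \<ge> c" using la_c dc by auto
  then have ij: "?i \<le> ?j" using la_d(3)[of ?i] dc by simp
  have "last_above (s n) d \<le> Max (?B ?i)" using n by (intro Max_ge fin) auto
  then have jF: "?j \<le> F ?i" using B[of ?i] by simp
  have "s n ?j < d" using la_d(3)[of ?j] dc by fastforce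
  then have "c - d < \<bar>s n ?i - s n ?j\<bar>" using i by linarith
  also have "\<dots> \<le> max (osc (F \<circ> F) (s n)) (osc ?G (s n))"
    by (rule abs_diff_le_max_osc[OF F gt s01[OF n1] i(1) ij jF])
  finally show False using n by linarith
qed

section \<open>Three alternatives against four thresholds\<close>

theorem corollary15:
  fixes \<alpha> :: "nat filter"
  assumes "nonprincipal_ultrafilter_on Npos \<alpha>"
    and "flat \<alpha>"
  shows "\<not> three_functions_property \<alpha>"
proof
  assume "three_functions_property \<alpha>"
  then obtain \<phi> :: "nat \<Rightarrow> nat \<times> nat" where
    phi: "bij_betw \<phi> Npos (Npos \<times> Npos)" and
    three: "\<forall>f \<in> Npos \<rightarrow> Npos. \<exists>A\<subseteq>Npos. (\<forall>\<^sub>F n in \<alpha>. n \<in> A) \<and>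
         ((\<exists>c. \<forall>n\<in>A. f n = c) \<or> finite_to_one_on f A \<or>
          (\<exists>g \<in> Npos \<rightarrow> Npos. inj_on g Npos \<and> (\<forall>n\<in>A. f n = g (fst (\<phi> n)))))"
    unfolding three_functions_property_def by (elim exE conjE) (rule that)
  from \<open>flat \<alpha>\<close> obtain s where s: "flatness_scale \<alpha> s" unfolding flat_def by blast
  then obtain r where "r > 0" and r: "\<forall>n\<in>Npos. (SUP i\<in>Npos. s n i) \<ge> r \<and> s n \<longlonglongrightarrow> 0"
    unfolding flatness_scale_def by blast
  have s01: "\<And>n i. n \<ge> 1 \<Longrightarrow> i \<ge> 1 \<Longrightarrow> s n i \<in> {0..1::real}"
    and sup: "\<And>n. n \<ge> 1 \<Longrightarrow> (SUP i\<in>Npos. s n i) \<ge> r"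
    and lim: "\<And>n. n \<ge> 1 \<Longrightarrow> s n \<longlonglongrightarrow> 0"
    and osc: "\<And>f. f \<in> increasing_funs \<Longrightarrow> ((\<lambda>n. osc f (s n)) \<longlongrightarrow> 0) \<alpha>"
    using s r unfolding flatness_scale_def by simp_all
  have "\<alpha> \<noteq> bot"
    using assms(1) by (auto simp: nonprincipal_ultrafilter_on_def ultrafilter_on_def)
  define h where "h c n = last_above (s n) c" for c n
  define const where "const c A \<longleftrightarrow> (\<exists>m. \<forall>n\<in>A. h c n = m)" for c A
  define proj where "proj c A \<longleftrightarrow>
    (\<exists>g\<in>Npos \<rightarrow> Npos. inj_on g Npos \<and> (\<forall>n\<in>A. h c n = g (fst (\<phi> n))))" for c A
  have unbounded: "\<exists>m. infinite (h d ` {n \<in> A. h c n = m})"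
    if "0 < d" "d < c" "c < r" "A \<subseteq> Npos" "\<forall>\<^sub>F n in \<alpha>. n \<in> A" for c d A
    unfolding h_def
    by (rule flatness_scale_last_above_unbounded[OF s01 sup lim osc \<open>\<alpha> \<noteq> bot\<close>]) (use that in auto)
  \<comment> \<open>Fix a fibre of \<open>h c\<close> in \<open>A \<inter> B\<close> on which
    \<open>h d\<close> takes infinitely many values. It rules out \<open>h d\<close> constant,
    \<open>h c\<close> finite-to-one, and both factoring through the first coordinate of
    \<open>\<phi>\<close>.\<close>
  have not_both: "\<not> ((const c A \<and> const d B) \<or>
      (finite_to_one_on (h c) A \<and> finite_to_one_on (h d) B) \<or> (proj c A \<and> proj d B))"
    if cd: "0 < d" "d < c" "c < r" and A: "A \<subseteq> Npos" "\<forall>\<^sub>F n in \<alpha>. n \<in> A"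
      and B: "B \<subseteq> Npos" "\<forall>\<^sub>F n in \<alpha>. n \<in> B" for c d A B
  proof -
    obtain m where m: "infinite (h d ` {n \<in> A \<inter> B. h c n = m})"
      using unbounded[OF cd, of "A \<inter> B"] A B eventually_conj by fastforce
    have "\<not> const d B"
    proof
      assume "const d B"
      then obtain q where "\<forall>n\<in>B. h d n = q" unfolding const_def by blast
      then have "h d ` {n \<in> A \<inter> B. h c n = m} \<subseteq> {q}" by auto
      with m show False using finite_subset by blast
    qed
    moreover have "\<not> finite_to_one_on (h c) A"
    proof
      assume "finite_to_one_on (h c) A"
      then have "finite {n \<in> A. h c n = m}" by (simp add: finite_to_one_on_def)
      then have "finite {n \<in> A \<inter> B. h c n = m}" by (rule rev_finite_subset) auto
      with m show False by blast
    qed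
    moreover have False if "proj c A" "proj d B"
    proof -
      from that obtain g g' where g: "inj_on g Npos" "\<forall>n\<in>A. h c n = g (fst (\<phi> n))"
        and g': "\<forall>n\<in>B. h d n = g' (fst (\<phi> n))" unfolding proj_def by blast
      \<comment> \<open>On the fibre \<open>g (fst (\<phi> n)) = m\<close>, so injectivity of
        \<open>g\<close> fixes the first coordinate and with it \<open>h d n\<close>.\<close>
      have "fst (\<phi> n) \<in> Npos" if "n \<in> A" for n
        using bij_betwE[OF phi] that A by (metis mem_Times_iff subsetD)
      then have "h d n = g' (the_inv_into Npos g m)" if "n \<in> A" "n \<in> B" "h c n = m" for n
        using that g g' by (metis the_inv_into_f_f)
      then have "h d ` {n \<in> A \<inter> B. h c n = m} \<subseteq> {g' (the_inv_into Npos g m)}" by auto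
      with m show False using finite_subset by blast
    qed
    ultimately show ?thesis by blast
  qed
  have alternatives: "\<exists>A\<subseteq>Npos. (\<forall>\<^sub>F n in \<alpha>. n \<in> A) \<and>
      (const c A \<or> finite_to_one_on (h c) A \<or> proj c A)" if "0 < c" "c < r" for c
  proof -
    have "h c \<in> Npos \<rightarrow> Npos"
      using last_above_ge_1[OF s01 lim sup that] by (auto simp: h_def)
    from bspec[OF three this] show ?thesis unfolding const_def proj_def by blast
  qed
  \<comment> \<open>The four thresholds are \<open>r/2\<close>, \<open>r/3\<close>,
    \<open>r/4\<close> and \<open>r/5\<close>; the list holds the comparisons needed for all
    pairs.\<close>
  have c: "0 < r/5" "r/5 < r/4" "r/4 < r/3" "r/3 < r/2" "r/2 < r"
    "r/5 < r/3" "r/5 < r/2" "r/4 < r/2" "r/3 < r" "r/4 < r" "r/5 < r" "0 < r/4" "0 < r/3" "0 < r/2"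
    using \<open>r > 0\<close> by auto
  obtain A where A: "A \<subseteq> Npos" "\<forall>\<^sub>F n in \<alpha>. n \<in> A"
    "const (r/2) A \<or> finite_to_one_on (h (r/2)) A \<or> proj (r/2) A" using alternatives c by blast
  obtain B where B: "B \<subseteq> Npos" "\<forall>\<^sub>F n in \<alpha>. n \<in> B"
    "const (r/3) B \<or> finite_to_one_on (h (r/3)) B \<or> proj (r/3) B" using alternatives c by blast
  obtain C where C: "C \<subseteq> Npos" "\<forall>\<^sub>F n in \<alpha>. n \<in> C"
    "const (r/4) C \<or> finite_to_one_on (h (r/4)) C \<or> proj (r/4) C" using alternatives c by blast
  obtain D where D: "D \<subseteq> Npos" "\<forall>\<^sub>F n in \<alpha>. n \<in> D"
    "const (r/5) D \<or> finite_to_one_on (h (r/5)) D \<or> proj (r/5) D" using alternatives c by blast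
  \<comment> \<open>Each of the six pairs excludes a shared alternative, so the pigeonhole argument
    becomes propositional.\<close>
  note not_both[OF c(13,4,5) A(1,2) B(1,2)] not_both[OF c(12,8,5) A(1,2) C(1,2)]
    not_both[OF c(1,7,5) A(1,2) D(1,2)] not_both[OF c(12,3,9) B(1,2) C(1,2)]
    not_both[OF c(1,6,9) B(1,2) D(1,2)] not_both[OF c(1,2,10) C(1,2) D(1,2)]
  with A(3) B(3) C(3) D(3) show False by argo
qed

end
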